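(* Let $f:B^n\to\mathbb{R}$ be a $C^{d+1}$-smooth function with $\max_{B^n}|f|=1$, and let $\omega=(\omega_1,\ldots,\omega_n):[-1,1]\to\mathbb{R}^n$ be a polynomial parametric curve of degree $s$ (each $\omega_i$ is a real polynomial in $t$ of degree at most $s$) with $\omega([-1,1])\subset B^n$. Put $g(t)=f(\omega(t))$, $t\in[-1,1]$. Then for each $t\in[-1,1]$ $$\sum_{|\alpha|=\left[\frac{d+1}{s}\right]+1}^{d+1}\|f^{(\alpha)}(\omega(t))\|\ \ge\ C(n,d,s)\,\|g^{(d+1)}(t)\| ,$$ with the positive constant $$C(n,d,s)=\frac{1}{s^{2(d+1)}(n+1)^{d+1}(d+1)^{(d+1)(n+2)}} .$$ In particular, $$\sum_{|\alpha|=\left[\frac{d+1}{s}\right]+1}^{d+1}\|f^{(\alpha)}\|\ \ge\ C(n,d,s)\,\|g^{(d+1)}\| ,$$ where the global norms of the derivatives are the maxima of the pointwise norms with respect to $t$, that is, $\|f^{(\alpha)}\|=\max_{t\in[-1,1]}\|f^{(\alpha)}(\omega(t))\|$ and $\|g^{(d+1)}\|=\max_{t\in[-1,1]}\|g^{(d+1)}(t)\|$.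
   Context: $B^n\subset\mathbb{R}^n$ is the unit ball. A function is $C^{d+1}$-smooth if it is $d+1$ times continuously differentiable. For a multi-index $\alpha=(\alpha_1,\ldots,\alpha_n)$ of nonnegative integers, $|\alpha|=\alpha_1+\cdots+\alpha_n$ and $f^{(\alpha)}=\partial^{|\alpha|}f/\partial x_1^{\alpha_1}\cdots\partial x_n^{\alpha_n}$; the pointwise norms $\|f^{(\alpha)}(\omega(t))\|$ and $\|g^{(d+1)}(t)\|$ of these real numbers are their absolute values. The sums run over all multi-indices $\alpha$ with $|\alpha|$ between the lower limit $\left[\frac{d+1}{s}\right]+1$ and $d+1$. $[x]$ denotes the integer part of $x$.
   Formalization: The lower summation limit [(d+1)/s]+1 is replaced by the ceiling of (d+1)/s, which differs only when s divides d+1; there the printed bound fails, e.g. f(x)=x_1^m, ω(t)=(t^s,0,…,0) with m=(d+1)/s gives 0 on the left and g^{(d+1)}=(d+1)!. *)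

theory Defs
  imports "HOL-Analysis.Analysis" "HOL-Computational_Algebra.Polynomial"
begin

text \<open>
  Functions on the closed unit ball are represented by total functions of which only the values on
  \<open>cball 0 1\<close> matter: all derivatives are taken within the ball. As the ball is convex with nonempty
  interior, Frechet derivatives within it are unique at every point
  (\<open>frechet_derivative_cball_eq\<close>), including boundary points (where
  a difference quotient along a single coordinate axis may leave the ball).
\<close>

definition partial_on :: "(real^'n) set \<Rightarrow> 'n \<Rightarrow> (real^'n \<Rightarrow> real) \<Rightarrow> real^'n \<Rightarrow> real" where
  "partial_on S i f x = frechet_derivative f (at x within S) (axis i 1)"

lemma frechet_derivative_cball_eq:
  fixes f :: "'a::real_normed_vector \<Rightarrow> real"
  assumes B: "(f has_derivative B) (at x within cball 0 1)" and x: "x \<in> cball 0 1"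
  shows "frechet_derivative f (at x within cball 0 1) = B"
proof -
  define A where "A = frechet_derivative f (at x within cball 0 1)"
  have A: "(f has_derivative A) (at x within cball 0 1)"
    unfolding A_def using B frechet_derivative_works differentiable_def by blast
  have lin: "linear A" "linear B"
    using A B has_derivative_linear by blast+
  have on_seg: "A (y - x) = B (y - x)" if y: "y \<in> cball 0 1" for y
  proof -
    define \<gamma> where "\<gamma> = (\<lambda>u::real. x + u *\<^sub>R (y - x))"
    have g: "(\<gamma> has_derivative (\<lambda>u. u *\<^sub>R (y - x))) (at 0 within {0..1})"
      unfolding \<gamma>_def by (auto intro!: derivative_eq_intros)
    have "\<gamma> ` {0..1} \<subseteq> cball 0 1"
    proof
      fix z assume "z \<in> \<gamma> ` {0..1}"
      then obtain u where u: "0 \<le> u" "u \<le> 1" "z = (1 - u) *\<^sub>R x + u *\<^sub>R y"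
        by (auto simp: \<gamma>_def algebra_simps)
      then show "z \<in> cball 0 1"
        using convexD_alt[OF convex_cball x y, of u] by simp
    qed
    then have "(f has_derivative A) (at (\<gamma> 0) within \<gamma> ` {0..1})"
      "(f has_derivative B) (at (\<gamma> 0) within \<gamma> ` {0..1})"
      using A B by (auto simp: \<gamma>_def intro: has_derivative_subset)
    then have "((f \<circ> \<gamma>) has_derivative (A \<circ> (\<lambda>u. u *\<^sub>R (y - x)))) (at 0 within {0..1})"
      "((f \<circ> \<gamma>) has_derivative (B \<circ> (\<lambda>u. u *\<^sub>R (y - x)))) (at 0 within {0..1})"
      by (auto intro: diff_chain_within[OF g])
    then have "((f \<circ> \<gamma>) has_vector_derivative A (y - x)) (at 0 within {0..1})"
      "((f \<circ> \<gamma>) has_vector_derivative B (y - x)) (at 0 within {0..1})"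
      using lin by (simp_all add: has_vector_derivative_def o_def linear_cmul)
    then show ?thesis
      using vector_derivative_unique_within_closed_interval[of 0 1 0 "f \<circ> \<gamma>"] by simp
  qed
  have "A y = B y" for y
  proof (cases "y = 0")
    case False
    define c where "c = 1 / norm y"
    have c: "c \<noteq> 0" "c *\<^sub>R y \<in> cball 0 1"
      using False by (auto simp: c_def)
    have "A (c *\<^sub>R y - x) = B (c *\<^sub>R y - x)" "A (0 - x) = B (0 - x)"
      using on_seg[OF c(2)] on_seg[of 0] by simp_all
    then have "c * A y = c * B y"
      using lin by (simp add: linear_diff linear_cmul linear_neg)
    then show ?thesis using c by simp
  qed (use lin in \<open>simp add: linear_0\<close>)
  then show ?thesis unfolding A_def by auto
qed

text \<open>
  \<open>Ck_on k S f\<close>: \<open>f\<close> is \<open>k\<close> times continuously differentiable on \<open>S\<close>. It is intended for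
  convex \<open>S\<close> with nonempty interior.
\<close>

primrec Ck_on :: "nat \<Rightarrow> (real^'n) set \<Rightarrow> (real^'n \<Rightarrow> real) \<Rightarrow> bool" where
  "Ck_on 0 S f \<longleftrightarrow> continuous_on S f"
| "Ck_on (Suc k) S f \<longleftrightarrow> f differentiable_on S \<and> (\<forall>i. Ck_on k S (partial_on S i f))"

text \<open>
  The linear order on the index type only serves to write the iterated derivative as
  $\partial_1^{\alpha_1} \cdots \partial_n^{\alpha_n} f$; every numeral type has one.
\<close>

definition multi_deriv_on ::
    "(real^'n::{finite,linorder}) set \<Rightarrow> ('n \<Rightarrow> nat) \<Rightarrow>
      (real^'n::{finite,linorder} \<Rightarrow> real) \<Rightarrow> real^'n::{finite,linorder} \<Rightarrow> real" where
  "multi_deriv_on S \<alpha> f =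
     foldr (\<lambda>i h. (partial_on S i ^^ \<alpha> i) h) (sorted_list_of_set UNIV) f"

definition multi_order :: "('n::finite \<Rightarrow> nat) \<Rightarrow> nat" where
  "multi_order \<alpha> = (\<Sum>i\<in>UNIV. \<alpha> i)"

text \<open>One-sided derivatives at the end points of the parameter interval.\<close>

definition nth_deriv_on :: "real set \<Rightarrow> nat \<Rightarrow> (real \<Rightarrow> real) \<Rightarrow> real \<Rightarrow> real" where
  "nth_deriv_on T k g = ((\<lambda>h t. vector_derivative h (at t within T)) ^^ k) g"

definition curve_const :: "nat \<Rightarrow> nat \<Rightarrow> nat \<Rightarrow> real" where
  "curve_const n d s =
     1 / (real s ^ (2 * (d + 1)) * real (n + 1) ^ (d + 1) * real (d + 1) ^ ((d + 1) * (n + 2)))"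

text \<open>
  The lowest order of differentiation in the sums. The source prints $[(d+1)/s] + 1$ with $[x]$
  the integer part of $x$. This agrees with the definition below unless \<open>s\<close> divides \<open>d + 1\<close>
  (\<open>lowest_order_eq_floor\<close>). If \<open>s\<close> divides \<open>d + 1\<close>, the printed bound is too large by one
  and the printed inequality fails: take $f(x) = x_1^m$ with $m = (d+1)/s$ and
  $\omega(t) = (t^s, 0, \ldots, 0)$; then $g^{(d+1)} = (d+1)!$, while every derivative of \<open>f\<close> of
  order greater than \<open>m\<close> vanishes. The case \<open>d = 0\<close>, \<open>s = 1\<close> is
  \<open>printed_bound_fails\<close>. The bound \<open>\<lceil>(d + 1) / s\<rceil>\<close> is what
  the chain rule gives, as the derivatives of \<open>\<omega>\<close> of order greater than \<open>s\<close> vanish.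
\<close>

definition lowest_order :: "nat \<Rightarrow> nat \<Rightarrow> nat" where
  "lowest_order d s = nat \<lceil>real (d + 1) / real s\<rceil>"

lemma lowest_order_eq_floor:
  assumes "s \<ge> 1" "\<not> s dvd d + 1"
  shows "lowest_order d s = nat \<lfloor>real (d + 1) / real s\<rfloor> + 1"
proof -
  have "real (d + 1) / real s \<notin> \<int>"
  proof
    assume "real (d + 1) / real s \<in> \<int>"
    then obtain z where "real (d + 1) / real s = of_int z"
      by (auto elim: Ints_cases)
    then have "of_int (int (d + 1)) = (of_int (int s * z) :: real)"
      using assms(1) by (simp add: field_simps)
    then have "int s dvd int (d + 1)"
      by (metis dvd_triv_left of_int_eq_iff)
    then show False
      using assms(2) by (metis int_dvd_int_iff)
  qed
  then have "\<lceil>real (d + 1) / real s\<rceil> = \<lfloor>real (d + 1) / real s\<rfloor> + 1"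
    by (simp add: ceiling_altdef) (metis Ints_of_int)
  moreover have "\<lfloor>real (d + 1) / real s\<rfloor> \<ge> 0"
    by simp
  ultimately show ?thesis
    by (simp add: lowest_order_def nat_add_distrib)
qed

lemma printed_bound_fails:
  fixes i :: "'n::{finite,linorder}"
  defines "f \<equiv> \<lambda>x::real^'n::{finite,linorder}. x $ i" and "\<omega> \<equiv> \<lambda>t::real. axis i t"
  shows "Ck_on 1 (cball 0 1) f"
    and "(SUP x\<in>cball 0 1. \<bar>f x\<bar>) = 1"
    and "\<forall>j. \<exists>p. degree p \<le> 1 \<and> (\<forall>t\<in>{-1..1}. \<omega> t $ j = poly p t)"
    and "\<omega> ` {-1..1} \<subseteq> cball 0 1"
    and "\<not> (\<Sum>\<alpha> | nat \<lfloor>real (0 + 1) / real 1\<rfloor> + 1 \<le> multi_order \<alpha> \<and> multi_order \<alpha> \<le> 0 + 1.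
            \<bar>multi_deriv_on (cball 0 1) \<alpha> f (\<omega> 0)\<bar>)
          \<ge> curve_const CARD('n) 0 1 * \<bar>nth_deriv_on {-1..1} (0 + 1) (\<lambda>t. f (\<omega> t)) 0\<bar>"
proof -
  have bl: "(f has_derivative f) F" for F
    unfolding f_def by (intro bounded_linear_imp_has_derivative bounded_linear_vec_nth)
  have f_le: "\<bar>f x\<bar> \<le> 1" if "x \<in> cball 0 1" for x
    using that component_le_norm_cart[of x i] by (simp add: f_def)
  have uniq: "frechet_derivative f (at x within cball 0 1) = f" if "x \<in> cball 0 1" for x
    using frechet_derivative_cball_eq[OF bl that] .
  have "continuous_on (cball 0 1) (partial_on (cball 0 1) j f)" for j
    by (rule continuous_on_eq[OF continuous_on_const[of _ "f (axis j 1)"]])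
      (simp add: partial_on_def uniq)
  moreover have "f differentiable_on cball 0 1"
    using bl by (auto simp: differentiable_on_def differentiable_def)
  ultimately show "Ck_on 1 (cball 0 1) f"
    by simp
  have "f (axis i 1) = 1" by (simp add: f_def)
  then show "(SUP x\<in>cball 0 1. \<bar>f x\<bar>) = 1"
    by (intro cSup_eq_maximum) (auto intro!: image_eqI[of _ _ "axis i 1"] f_le)
  show "\<forall>j. \<exists>p. degree p \<le> 1 \<and> (\<forall>t\<in>{-1..1}. \<omega> t $ j = poly p t)"
  proof
    fix j
    show "\<exists>p. degree p \<le> 1 \<and> (\<forall>t\<in>{-1..1}. \<omega> t $ j = poly p t)"
      by (rule exI[of _ "if j = i then [:0, 1:] else 0"]) (auto simp: \<omega>_def axis_def)
  qed
  show "\<omega> ` {-1..1} \<subseteq> cball 0 1"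
  proof -
    have "\<omega> t = t *\<^sub>R axis i 1" for t
      by (simp add: \<omega>_def vec_eq_iff axis_def)
    then show ?thesis by auto
  qed
  have "((\<lambda>t. f (\<omega> t)) has_vector_derivative 1) (at 0 within {-1..1})"
    by (auto simp: f_def \<omega>_def intro!: derivative_eq_intros)
  then have "nth_deriv_on {-1..1} (0 + 1) (\<lambda>t. f (\<omega> t)) 0 = 1"
    unfolding nth_deriv_on_def
    by (simp add: vector_derivative_within_closed_interval)
  moreover have "{\<alpha> :: 'n::{finite,linorder} \<Rightarrow> nat. nat \<lfloor>real (0 + 1) / real 1\<rfloor> + 1 \<le> multi_order \<alpha>
      \<and> multi_order \<alpha> \<le> 0 + 1} = {}"
    by auto
  moreover have "curve_const CARD('n) 0 1 > 0"
    by (simp add: curve_const_def)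
  ultimately show "\<not> (\<Sum>\<alpha> | nat \<lfloor>real (0 + 1) / real 1\<rfloor> + 1 \<le> multi_order \<alpha> \<and> multi_order \<alpha> \<le> 0 + 1.
            \<bar>multi_deriv_on (cball 0 1) \<alpha> f (\<omega> 0)\<bar>)
          \<ge> curve_const CARD('n) 0 1 * \<bar>nth_deriv_on {-1..1} (0 + 1) (\<lambda>t. f (\<omega> t)) 0\<bar>"
    by (simp only: sum.empty)
qed

end

theory Submission
  imports Defs
begin

text \<open>
  By the chain rule, $g^{(k)} = \sum_{|\alpha| \le k} f^{(\alpha)}(\omega)\, P_{k,\alpha}$ with polynomials
  $P_{k,\alpha}$ of degree at most $|\alpha| s - k$; in particular $P_{k,\alpha} = 0$ if $|\alpha| s < k$,
  which is where the lowest order in the sum comes from. As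
  $P_{k+1,\alpha} = P_{k,\alpha}' + \sum_i P_{k,\alpha - e_i}\, \omega_i'$ and the components of
  \<open>\<omega>\<close> are bounded by \<open>1\<close>, Markov's inequality for polynomials bounds $P_{d+1,\alpha}$ by
  $1 / C(n,d,s)$ on $[-1,1]$.
\<close>

subsection \<open>Markov's inequality\<close>

text \<open>The constant leaves so much room that Markov's inequality may lose a factor 2 at every
  differentiation: passing from order k to k + 1 costs 2 s^2 (k^2 + k + 1), which stays below the
  factor s^2 (n+1) (d+1)^(n+2) that each of the d + 1 differentiations contributes to 1 / C(n,d,s).
  The obstacle is the formula for g^(k) itself. \<open>multi_deriv_on\<close> differentiates in a
  fixed order, whereas the chain rule puts each new partial derivative on the outside, so partial
  derivatives have to be interchanged. Moreover, the curve may touch the unit sphere, where the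
  usual difference quotients leave the ball. Symmetry is therefore shown in the interior and carried
  to the boundary by continuity.\<close>

fun cheb_poly :: "nat \<Rightarrow> real poly" where
  "cheb_poly 0 = 1"
| "cheb_poly (Suc 0) = [:0, 1:]"
| "cheb_poly (Suc (Suc n)) = [:0, 2:] * cheb_poly (Suc n) - cheb_poly n"

lemma degree_cheb_poly_le: "degree (cheb_poly n) \<le> n"
proof (induction n rule: cheb_poly.induct)
  case (3 n)
  have "degree ([:0, 2:] * cheb_poly (Suc n)) \<le> Suc (Suc n)"
    using 3 degree_mult_le[of "[:0, 2:]" "cheb_poly (Suc n)"] by simp
  then show ?case
    using 3 by (simp only: cheb_poly.simps) (intro degree_diff_le, auto)
qed auto

lemma poly_cheb_poly_cos: "poly (cheb_poly n) (cos x) = cos (real n * x)"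
proof (induction n rule: cheb_poly.induct)
  case (3 n)
  have "cos (real (Suc (Suc n)) * x) + cos (real n * x) = 2 * cos x * cos (real (Suc n) * x)"
  proof -
    have "real (Suc (Suc n)) * x = real (Suc n) * x + x" "real n * x = real (Suc n) * x - x"
      by (simp_all add: algebra_simps)
    then show ?thesis by (simp only: cos_add cos_diff) simp
  qed
  then show ?case
    using 3 by simp
qed auto

lemma poly_cheb_poly_1 [simp]: "poly (cheb_poly n) 1 = 1"
  using poly_cheb_poly_cos[of n 0] by simp

text \<open>The origin of the Markov constant: differentiating the recursion at 1 gives a(n+2) = 2 +
  2 a(n+1) - a(n), which n^2 solves.\<close>

lemma poly_pderiv_cheb_poly_1: "poly (pderiv (cheb_poly n)) 1 = (real n)\<^sup>2"
proof (induction n rule: cheb_poly.induct)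
  case (3 n)
  then show ?case
    by (simp add: pderiv_diff pderiv_mult pderiv_smult pderiv_pCons power2_eq_square algebra_simps)
qed (auto simp: pderiv_pCons)

text \<open>
  If the bound failed at \<open>1\<close>, some multiple \<open>c T\<^sub>s\<close> of the Chebyshev polynomial with \<open>c > M\<close> would
  have the same derivative there. Then \<open>r = c T\<^sub>s - p\<close> alternates in sign at the \<open>s + 1\<close> extremal
  points of \<open>T\<^sub>s\<close>, so \<open>r'\<close> has \<open>s - 1\<close> zeros to the left of its zero at \<open>1\<close>: one too many.
\<close>

lemma Markov_endpoint_upper:
  fixes p :: "real poly"
  assumes deg: "degree p \<le> s" and bound: "\<And>x. \<bar>x\<bar> \<le> 1 \<Longrightarrow> \<bar>poly p x\<bar> \<le> M"
  shows "poly (pderiv p) 1 \<le> (real s)\<^sup>2 * M"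
proof (rule ccontr)
  assume "\<not> ?thesis"
  then have big: "poly (pderiv p) 1 > (real s)\<^sup>2 * M" by simp
  have "M \<ge> 0" using bound[of 0] by simp
  have s: "s > 0"
  proof (rule ccontr)
    assume "\<not> s > 0"
    then have "pderiv p = 0" using deg by (simp add: pderiv_eq_0_iff)
    then show False using big \<open>\<not> s > 0\<close> by simp
  qed
  define c where "c = poly (pderiv p) 1 / (real s)\<^sup>2"
  have c: "c > M" "c * (real s)\<^sup>2 = poly (pderiv p) 1"
    using big s by (auto simp: c_def field_simps)
  define r where "r = smult c (cheb_poly s) - p"
  \<comment> \<open>The extremal points of T_s on [-1, 1], from right to left: T_s takes the value
    (-1)^k at \<open>x k\<close>.\<close>
  define x where "x k = cos (real k * pi / real s)" for k
  have r1: "poly (pderiv r) 1 = 0"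
    using c by (simp add: r_def pderiv_diff pderiv_smult poly_pderiv_cheb_poly_1)
  have deg_r: "degree r \<le> s"
    unfolding r_def using deg degree_cheb_poly_le[of s]
    by (intro degree_diff_le) (auto intro: le_trans[OF degree_smult_le])
  have x_le: "\<bar>x k\<bar> \<le> 1" for k
    by (simp add: x_def)
  have x_less: "x l < x k" if "k < l" "l \<le> s" for k l
    unfolding x_def
  proof (rule cos_monotone_0_pi)
    show "real l * pi / real s \<le> pi" using that s by (simp add: field_simps)
    show "real k * pi / real s < real l * pi / real s"
      using that s by (simp add: divide_strict_right_mono)
  qed simp
  have sign: "(-1) ^ k * poly r (x k) > 0" for k
  proof -
    have "poly (cheb_poly s) (x k) = (-1) ^ k"
      using s by (simp add: x_def poly_cheb_poly_cos mult.commute)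
    moreover have "\<bar>poly p (x k)\<bar> < c"
      using bound[OF x_le[of k]] c(1) by linarith
    ultimately show ?thesis
      by (cases "even k") (auto simp: r_def)
  qed
  have "\<exists>y. x (Suc k) < y \<and> y < x k \<and> poly r y = 0" if "k < s" for k
  proof -
    have "poly r (x (Suc k)) * poly r (x k) < 0"
      using sign[of k] sign[of "Suc k"]
      by (cases "even k") (auto simp: mult_neg_pos mult_pos_neg)
    then show ?thesis
      using poly_IVT[of "x (Suc k)" "x k" r] x_less[of k "Suc k"] that by auto
  qed
  then obtain y where y: "x (Suc k) < y k" "y k < x k" "poly r (y k) = 0" if "k < s" for k
    by metis
  have y_less: "y l < y k" if "k < l" "l < s" for k l
  proof -
    have "x l \<le> x (Suc k)"
      using x_less[of "Suc k" l] that by (cases "l = Suc k") auto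
    then show ?thesis using y[of l] y[of k] that by auto
  qed
  have "\<exists>z. y (Suc k) < z \<and> z < y k \<and> poly (pderiv r) z = 0" if "Suc k < s" for k
    using poly_MVT[of "y (Suc k)" "y k" r] y_less[of k "Suc k"] y[of k] y[of "Suc k"] that by auto
  then obtain z where z: "y (Suc k) < z k" "z k < y k" "poly (pderiv r) (z k) = 0"
    if "Suc k < s" for k
    by metis
  have z_less: "z l < z k" if "k < l" "Suc l < s" for k l
  proof -
    have "y l \<le> y (Suc k)"
      using y_less[of "Suc k" l] that by (cases "l = Suc k") auto
    then show ?thesis using z[of l] z[of k] that by auto
  qed
  have z_less_1: "z k < 1" if "Suc k < s" for k
    using z[of k] y[of k] x_le[of k] that by auto
  have "inj_on z {..<s - 1}"
  proof (rule linorder_inj_onI)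
    show "z k \<noteq> z l" if "k < l" "l \<in> {..<s - 1}" for k l
      using z_less[of k l] that by fastforce
  qed auto
  then have "card (z ` {..<s - 1}) = s - 1"
    by (simp add: card_image)
  moreover have "1 \<notin> z ` {..<s - 1}"
  proof
    assume "1 \<in> z ` {..<s - 1}"
    then obtain k where "Suc k < s" "z k = 1" by (auto simp: less_diff_conv)
    then show False using z_less_1[of k] by simp
  qed
  ultimately have "card (insert 1 (z ` {..<s - 1})) = s"
    using s by simp
  moreover have "insert 1 (z ` {..<s - 1}) \<subseteq> {u. poly (pderiv r) u = 0}"
    using r1 z by auto
  moreover have "r \<noteq> 0" using sign[of 0] by auto
  moreover have nz: "pderiv r \<noteq> 0"
  proof
    assume "pderiv r = 0"
    then obtain h where "r = [:h:]" using pderiv_iszero by blast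
    then show False using sign[of 0] sign[of 1] by simp
  qed
  ultimately have "s \<le> degree (pderiv r)"
    using card_mono[OF poly_roots_finite[OF nz]] card_poly_roots_bound[OF nz] by (metis le_trans)
  then show False
    using deg_r s by (simp add: degree_pderiv)
qed

lemma Markov_endpoint:
  fixes p :: "real poly"
  assumes "degree p \<le> s" and "\<And>x. \<bar>x\<bar> \<le> 1 \<Longrightarrow> \<bar>poly p x\<bar> \<le> M"
  shows "\<bar>poly (pderiv p) 1\<bar> \<le> (real s)\<^sup>2 * M"
  using Markov_endpoint_upper[of p s M] Markov_endpoint_upper[of "- p" s M] assms
  by (auto simp: abs_le_iff pderiv_minus)

text \<open>
  The sharp constant is \<open>s\<^sup>2\<close>. The factor \<open>2\<close>, absorbed by $(n+1)^{d+1}$ in $C(n,d,s)$, allows reducing to the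
  end point of \<open>[-1, t]\<close> or \<open>[t, 1]\<close>, whichever is longer.
\<close>

lemma Markov_weak:
  fixes p :: "real poly"
  assumes deg: "degree p \<le> s" and bound: "\<And>x. \<bar>x\<bar> \<le> 1 \<Longrightarrow> \<bar>poly p x\<bar> \<le> M" and t: "\<bar>t\<bar> \<le> 1"
  shows "\<bar>poly (pderiv p) t\<bar> \<le> 2 * (real s)\<^sup>2 * M"
proof -
  have nonneg: "\<bar>poly (pderiv p) t\<bar> \<le> 2 * (real s)\<^sup>2 * M"
    if deg: "degree p \<le> s" and bound: "\<And>x. \<bar>x\<bar> \<le> 1 \<Longrightarrow> \<bar>poly p x\<bar> \<le> M" and t: "0 \<le> t" "t \<le> 1"
    for p :: "real poly" and t
  proof -
    \<comment> \<open>The affine map sends -1 to -1 and 1 to t. Its slope (t + 1) / 2 is at least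
      1/2, whence the factor 2.\<close>
    define q where "q = pcompose p [:(t - 1) / 2, (t + 1) / 2:]"
    have "degree q \<le> degree p * 1"
      unfolding q_def degree_pcompose by (intro mult_left_mono) auto
    then have "\<bar>poly (pderiv q) 1\<bar> \<le> (real s)\<^sup>2 * M"
    proof (intro Markov_endpoint)
      fix x :: real assume "\<bar>x\<bar> \<le> 1"
      then have "\<bar>(t - 1) / 2 + x * ((t + 1) / 2)\<bar> \<le> 1"
        using t mult_right_mono[of x 1 "t + 1"] mult_right_mono[of "-1" x "t + 1"]
        by (auto simp: abs_le_iff field_simps)
      then show "\<bar>poly q x\<bar> \<le> M"
        using bound by (simp add: q_def poly_pcompose)
    qed (use deg in simp)
    also have "poly (pderiv q) 1 = poly (pderiv p) t * ((t + 1) / 2)"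
      by (simp add: q_def pderiv_pcompose poly_pcompose pderiv_pCons add_divide_distrib diff_divide_distrib)
    finally have "\<bar>poly (pderiv p) t\<bar> * (t + 1) \<le> 2 * (real s)\<^sup>2 * M"
      using t by (simp add: abs_mult)
    moreover have "\<bar>poly (pderiv p) t\<bar> * 1 \<le> \<bar>poly (pderiv p) t\<bar> * (t + 1)"
      using t by (intro mult_left_mono) auto
    ultimately show ?thesis by simp
  qed
  show ?thesis
  proof (cases "t \<ge> 0")
    case True
    then show ?thesis using nonneg[of p t] assms by auto
  next
    case False
    \<comment> \<open>Reflection at 0 turns a negative t into the case already treated.\<close>
    have "\<bar>poly (pderiv (pcompose p [:0, -1:])) (- t)\<bar> \<le> 2 * (real s)\<^sup>2 * M"
      using False assms by (intro nonneg) (auto simp: degree_pcompose poly_pcompose)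
    then show ?thesis
      by (simp add: pderiv_pcompose poly_pcompose pderiv_pCons)
  qed
qed

subsection \<open>Mixed partial derivatives within a set\<close>

text \<open>\<open>frechet_derivative\<close> is a choice among the derivatives. Functions that
  agree on S have the same derivatives within S, so the same one is chosen, whether or not it exists
  or is unique.\<close>

lemma partial_on_cong:
  assumes "\<And>x. x \<in> S \<Longrightarrow> f x = h x" "x \<in> S"
  shows "partial_on S i f x = partial_on S i h x"
proof -
  have "(f has_derivative D) (at x within S) \<longleftrightarrow> (h has_derivative D) (at x within S)" for D
    using assms by (metis has_derivative_transform)
  then show ?thesis by (simp add: partial_on_def frechet_derivative_def)
qed

lemma partial_on_funpow_cong:
  assumes "\<And>x. x \<in> S \<Longrightarrow> f x = h x" "x \<in> S"
  shows "(partial_on S i ^^ k) f x = (partial_on S i ^^ k) h x"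
  using assms(2) by (induction k arbitrary: x) (auto simp: assms(1) intro: partial_on_cong)

lemma Ck_on_continuous: "Ck_on k S f \<Longrightarrow> continuous_on S f"
  by (cases k) (auto intro: differentiable_imp_continuous_on)

lemma Ck_on_le: "Ck_on l S f \<Longrightarrow> k \<le> l \<Longrightarrow> Ck_on k S f"
proof (induction l arbitrary: k f)
  case (Suc l)
  then show ?case by (cases k) (auto intro: differentiable_imp_continuous_on)
qed auto

lemma Ck_on_funpow_partial_on: "Ck_on (k + l) S f \<Longrightarrow> Ck_on l S ((partial_on S i ^^ k) f)"
  by (induction k arbitrary: f) (auto simp: funpow_swap1)

text \<open>All partial derivatives at a point are values of one linear map, so the chain rule also
  holds at boundary points of S, where axis-parallel segments may leave S.\<close>

lemma differentiable_on_chain_vector_derivative: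
  fixes f :: "real^'n \<Rightarrow> real" and \<gamma> :: "real \<Rightarrow> real^'n"
  assumes f: "f differentiable_on S" and \<gamma>: "(\<gamma> has_vector_derivative v) (at t within T)"
    and sub: "\<gamma> ` T \<subseteq> S" and t: "t \<in> T"
  shows "((\<lambda>u. f (\<gamma> u)) has_vector_derivative (\<Sum>i\<in>UNIV. v $ i * partial_on S i f (\<gamma> t))) (at t within T)"
proof -
  define D where "D = frechet_derivative f (at (\<gamma> t) within S)"
  have D: "(f has_derivative D) (at (\<gamma> t) within S)"
    using f sub t by (auto simp: D_def differentiable_on_def frechet_derivative_works[symmetric])
  have lin: "linear D"
    using D has_derivative_linear by blast
  have "((f \<circ> \<gamma>) has_derivative (D \<circ> (\<lambda>u. u *\<^sub>R v))) (at t within T)"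
    using \<gamma> has_derivative_subset[OF D sub]
    unfolding has_vector_derivative_def by (rule diff_chain_within)
  then have "((\<lambda>u. f (\<gamma> u)) has_vector_derivative D v) (at t within T)"
    by (simp add: has_vector_derivative_def o_def linear_cmul[OF lin])
  also have "D v = D (\<Sum>i\<in>UNIV. (v $ i) *\<^sub>R axis i 1)"
    using basis_expansion[of v] by (simp add: scalar_mult_eq_scaleR)
  also have "\<dots> = (\<Sum>i\<in>UNIV. v $ i * partial_on S i f (\<gamma> t))"
    unfolding partial_on_def D_def[symmetric] by (simp add: linear_sum[OF lin] linear_cmul[OF lin])
  finally show ?thesis .
qed

text \<open>Makes partial derivatives accessible to the one-variable mean value theorem.\<close>

lemma partial_on_line:
  fixes f :: "real^'n \<Rightarrow> real"
  assumes "f differentiable_on S" and "\<And>u. u \<in> T \<Longrightarrow> p + u *\<^sub>R axis i 1 \<in> S" and "t \<in> T"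
  shows "((\<lambda>u. f (p + u *\<^sub>R axis i 1)) has_real_derivative partial_on S i f (p + t *\<^sub>R axis i 1))
    (at t within T)"
proof -
  have "((\<lambda>u. p + u *\<^sub>R axis i 1) has_vector_derivative axis i 1) (at t within T)"
    by (auto intro!: derivative_eq_intros simp: has_vector_derivative_def)
  from differentiable_on_chain_vector_derivative[OF assms(1) this] assms(2,3)
  have "((\<lambda>u. f (p + u *\<^sub>R axis i 1)) has_vector_derivative
      (\<Sum>j\<in>UNIV. axis i 1 $ j * partial_on S j f (p + t *\<^sub>R axis i 1))) (at t within T)"
    by auto
  moreover have "(\<Sum>j\<in>UNIV. axis i 1 $ j * partial_on S j f (p + t *\<^sub>R axis i 1))
      = (\<Sum>j\<in>UNIV. if j = i then partial_on S j f (p + t *\<^sub>R axis i 1) else 0)"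
    by (intro sum.cong) (auto simp: axis_def)
  ultimately show ?thesis
    by (simp add: has_real_derivative_iff_has_vector_derivative)
qed

section \<open>Symmetry of second partial derivatives\<close>

lemma mvt_real_within:
  fixes \<phi> :: "real \<Rightarrow> real"
  assumes "a < b" and "\<And>u. u \<in> {a..b} \<Longrightarrow> (\<phi> has_real_derivative \<phi>' u) (at u within {a..b})"
  obtains u where "u \<in> {a<..<b}" "\<phi> b - \<phi> a = (b - a) * \<phi>' u"
proof -
  have "\<exists>u\<in>{a<..<b}. \<phi> b - \<phi> a = \<phi>' u * (b - a)"
    using assms by (intro mvt_simple) (auto simp: has_field_derivative_def)
  then show thesis using that by (auto simp: mult.commute)
qed

text \<open>The mean value theorem is applied in direction i, then in direction j. The left-hand
  side is symmetric in i and j, so exchanging them yields the other mixed derivative from the same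
  number.\<close>

lemma partial_on_second_difference:
  fixes f :: "real^'n \<Rightarrow> real"
  assumes f: "f differentiable_on S" "partial_on S i f differentiable_on S"
    and h: "h > 0" and sub: "cball x (2 * h) \<subseteq> S"
  obtains \<xi> where "dist x \<xi> \<le> 2 * h"
    "f (x + h *\<^sub>R axis i 1 + h *\<^sub>R axis j 1) - f (x + h *\<^sub>R axis i 1) - f (x + h *\<^sub>R axis j 1) + f x
      = h\<^sup>2 * partial_on S j (partial_on S i f) \<xi>"
proof -
  define e :: "'n \<Rightarrow> real^'n" where "e = (\<lambda>i. axis i 1)"
  have dist_le: "dist x (x + u *\<^sub>R e i + v *\<^sub>R e j) \<le> 2 * h" if "u \<in> {0..h}" "v \<in> {0..h}" for u v
  proof -
    have "dist x (x + w) = norm w" for w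
      by (simp add: dist_norm)
    then have "dist x (x + u *\<^sub>R e i + v *\<^sub>R e j) = norm (u *\<^sub>R e i + v *\<^sub>R e j)"
      by (simp only: add.assoc)
    also have "\<dots> \<le> norm (u *\<^sub>R e i) + norm (v *\<^sub>R e j)" by (rule norm_triangle_ineq)
    also have "\<dots> \<le> 2 * h" using that by (simp add: e_def)
    finally show ?thesis .
  qed
  then have mem: "x + u *\<^sub>R e i + v *\<^sub>R e j \<in> S" if "u \<in> {0..h}" "v \<in> {0..h}" for u v
    using sub that by auto
  \<comment> \<open>The second difference is the increment of \<open>\<phi>\<close> from 0 to
    \<open>h\<close>.\<close>
  define \<phi> where "\<phi> = (\<lambda>u. f (x + h *\<^sub>R e j + u *\<^sub>R e i) - f (x + u *\<^sub>R e i))"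
  have "(\<phi> has_real_derivative
      partial_on S i f (x + h *\<^sub>R e j + u *\<^sub>R e i) - partial_on S i f (x + u *\<^sub>R e i)) (at u within {0..h})"
    if "u \<in> {0..h}" for u
    unfolding \<phi>_def e_def using that mem[of _ h] mem[of _ 0] h
    by (intro DERIV_diff partial_on_line f) (auto simp: e_def algebra_simps)
  then obtain u where u: "u \<in> {0<..<h}"
    "\<phi> h - \<phi> 0 = (h - 0) * (partial_on S i f (x + h *\<^sub>R e j + u *\<^sub>R e i) - partial_on S i f (x + u *\<^sub>R e i))"
    by (rule mvt_real_within[OF h])
  have "((\<lambda>v. partial_on S i f (x + u *\<^sub>R e i + v *\<^sub>R e j)) has_real_derivative
      partial_on S j (partial_on S i f) (x + u *\<^sub>R e i + v *\<^sub>R e j)) (at v within {0..h})"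
    if "v \<in> {0..h}" for v
    unfolding e_def using that mem[of u] u
    by (intro partial_on_line f) (auto simp: e_def)
  then obtain v where v: "v \<in> {0<..<h}"
    "partial_on S i f (x + u *\<^sub>R e i + h *\<^sub>R e j) - partial_on S i f (x + u *\<^sub>R e i + 0 *\<^sub>R e j)
      = (h - 0) * partial_on S j (partial_on S i f) (x + u *\<^sub>R e i + v *\<^sub>R e j)"
    by (rule mvt_real_within[OF h])
  have "x + h *\<^sub>R e j + w = x + w + h *\<^sub>R e j" for w by simp
  with u(2) v(2) have "f (x + h *\<^sub>R e i + h *\<^sub>R e j) - f (x + h *\<^sub>R e i) - f (x + h *\<^sub>R e j) + f x
      = h\<^sup>2 * partial_on S j (partial_on S i f) (x + u *\<^sub>R e i + v *\<^sub>R e j)"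
    by (simp add: \<phi>_def power2_eq_square)
  then show thesis
    using that[of "x + u *\<^sub>R e i + v *\<^sub>R e j"] dist_le[of u v] u v by (simp add: e_def)
qed

text \<open>Both mixed derivatives, taken at suitable points near x, equal the same second
  difference divided by h^2. Continuity at x makes them agree in the limit.\<close>

lemma partial_on_commute_interior:
  fixes f :: "real^'n \<Rightarrow> real"
  assumes f: "Ck_on 2 S f" and x: "x \<in> interior S"
  shows "partial_on S j (partial_on S i f) x = partial_on S i (partial_on S j f) x"
proof -
  have diff: "f differentiable_on S" "partial_on S k f differentiable_on S" for k
    using f by (simp_all add: numeral_2_eq_2)
  have cont: "isCont (partial_on S k (partial_on S l f)) x" for k l
    using f x by (auto simp: numeral_2_eq_2 intro: continuous_on_interior)
  have close: "\<bar>partial_on S j (partial_on S i f) x - partial_on S i (partial_on S j f) x\<bar> < 2 * \<epsilon>"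
    if "\<epsilon> > 0" for \<epsilon>
  proof -
    obtain d1 where d1: "d1 > 0" "\<And>y. dist y x < d1 \<Longrightarrow>
        dist (partial_on S j (partial_on S i f) y) (partial_on S j (partial_on S i f) x) < \<epsilon>"
      using cont[of j i] \<open>\<epsilon> > 0\<close> by (auto simp: continuous_at_eps_delta)
    obtain d2 where d2: "d2 > 0" "\<And>y. dist y x < d2 \<Longrightarrow>
        dist (partial_on S i (partial_on S j f) y) (partial_on S i (partial_on S j f) x) < \<epsilon>"
      using cont[of i j] \<open>\<epsilon> > 0\<close> by (auto simp: continuous_at_eps_delta)
    obtain r where r: "r > 0" "cball x r \<subseteq> S"
      using x by (auto simp: mem_interior_cball)
    \<comment> \<open>The intermediate points have distance up to \<open>2 * h\<close> from
      \<open>x\<close>; a quarter of the minimum keeps this strictly below all three radii.\<close>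
    define h where "h = Min {d1, d2, r} / 4"
    have h: "h > 0" "2 * h < d1" "2 * h < d2" "cball x (2 * h) \<subseteq> S"
      using d1(1) d2(1) r by (auto simp: h_def min_def split: if_splits)
    obtain \<xi> where \<xi>: "dist x \<xi> \<le> 2 * h"
      "f (x + h *\<^sub>R axis i 1 + h *\<^sub>R axis j 1) - f (x + h *\<^sub>R axis i 1) - f (x + h *\<^sub>R axis j 1) + f x
        = h\<^sup>2 * partial_on S j (partial_on S i f) \<xi>"
      using partial_on_second_difference[OF diff h(1,4)] by blast
    obtain \<eta> where \<eta>: "dist x \<eta> \<le> 2 * h"
      "f (x + h *\<^sub>R axis j 1 + h *\<^sub>R axis i 1) - f (x + h *\<^sub>R axis j 1) - f (x + h *\<^sub>R axis i 1) + f x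
        = h\<^sup>2 * partial_on S i (partial_on S j f) \<eta>"
      using partial_on_second_difference[OF diff h(1,4)] by blast
    have swap: "x + h *\<^sub>R axis j 1 + h *\<^sub>R axis i 1 = x + h *\<^sub>R axis i 1 + h *\<^sub>R axis j 1" by simp
    have "h\<^sup>2 * partial_on S j (partial_on S i f) \<xi> = h\<^sup>2 * partial_on S i (partial_on S j f) \<eta>"
      using \<xi>(2) \<eta>(2)[unfolded swap] by linarith
    then have "partial_on S j (partial_on S i f) \<xi> = partial_on S i (partial_on S j f) \<eta>"
      using h(1) by simp
    then show ?thesis
      using d1(2)[of \<xi>] d2(2)[of \<eta>] \<xi>(1) \<eta>(1) h by (auto simp: dist_real_def dist_commute)
  qed
  have "\<bar>partial_on S j (partial_on S i f) x - partial_on S i (partial_on S j f) x\<bar> \<le> 0"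
  proof (rule field_le_epsilon)
    fix \<epsilon> :: real assume "\<epsilon> > 0"
    then show "\<bar>partial_on S j (partial_on S i f) x - partial_on S i (partial_on S j f) x\<bar> \<le> 0 + \<epsilon>"
      using close[of "\<epsilon> / 2"] by simp
  qed
  then show ?thesis by simp
qed

text \<open>The difference of the two sides is continuous on S and vanishes on the interior, which
  is dense in S.\<close>

lemma partial_on_commute:
  fixes f :: "real^'n \<Rightarrow> real"
  assumes f: "Ck_on 2 S f" and x: "x \<in> S" and S: "S = closure (interior S)"
  shows "partial_on S j (partial_on S i f) x = partial_on S i (partial_on S j f) x"
proof -
  define D where "D = (\<lambda>x. partial_on S j (partial_on S i f) x - partial_on S i (partial_on S j f) x)"
  have "continuous_on S D"
    using f unfolding D_def by (intro continuous_on_diff) (auto simp: numeral_2_eq_2)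
  then have "D x = 0"
    using continuous_constant_on_closure[of "interior S" D 0 x] partial_on_commute_interior[OF f] x S
    by (auto simp: D_def)
  then show ?thesis by (simp add: D_def)
qed

lemma partial_on_funpow_commute:
  fixes f :: "real^'n \<Rightarrow> real"
  assumes "Ck_on (Suc k) S f" and "x \<in> S" and S: "S = closure (interior S)"
  shows "partial_on S j ((partial_on S i ^^ k) f) x = (partial_on S i ^^ k) (partial_on S j f) x"
  using assms(1,2)
proof (induction k arbitrary: x)
  case (Suc k)
  have "Ck_on 2 S ((partial_on S i ^^ k) f)"
    using Suc.prems(1) by (intro Ck_on_funpow_partial_on) (simp add: numeral_2_eq_2)
  then have "partial_on S j ((partial_on S i ^^ Suc k) f) x
      = partial_on S i (partial_on S j ((partial_on S i ^^ k) f)) x"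
    using partial_on_commute Suc.prems(2) S by simp
  also have "\<dots> = partial_on S i ((partial_on S i ^^ k) (partial_on S j f)) x"
    using Suc Ck_on_le[of "Suc (Suc k)" S f "Suc k"] by (intro partial_on_cong) auto
  finally show ?case by simp
qed simp

lemma Ck_on_foldr_partial_on:
  "Ck_on (sum_list (map \<alpha> xs) + l) S f \<Longrightarrow>
    Ck_on l S (foldr (\<lambda>i h. (partial_on S i ^^ \<alpha> i) h) xs f)"
proof (induction xs arbitrary: l)
  case (Cons i xs)
  then show ?case by (auto intro!: Ck_on_funpow_partial_on simp: add_ac)
qed simp

text \<open>The new derivative starts outermost and is moved inward past the blocks of other indices
  until it meets the block of j. Since \<open>xs\<close> is distinct, the blocks further inside are
  unaffected.\<close>

lemma partial_on_foldr:
  fixes f :: "real^'n \<Rightarrow> real"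
  assumes "Ck_on (Suc (sum_list (map \<alpha> xs))) S f" and "x \<in> S" and S: "S = closure (interior S)"
    and "distinct xs" "j \<in> set xs"
  shows "partial_on S j (foldr (\<lambda>i h. (partial_on S i ^^ \<alpha> i) h) xs f) x
    = foldr (\<lambda>i h. (partial_on S i ^^ (\<alpha>(j := Suc (\<alpha> j))) i) h) xs f x"
  using assms(1,2,4,5)
proof (induction xs arbitrary: x)
  case (Cons i xs)
  define h where "h = foldr (\<lambda>i h. (partial_on S i ^^ \<alpha> i) h) xs f"
  show ?case
  proof (cases "i = j")
    case True
    have "foldr (\<lambda>i h. (partial_on S i ^^ (\<alpha>(j := Suc (\<alpha> j))) i) h) xs f = h"
      unfolding h_def using True Cons.prems by (intro foldr_cong) auto
    then show ?thesis using True by (simp add: h_def)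
  next
    case False
    have "Ck_on (Suc (\<alpha> i)) S h"
      unfolding h_def using Cons.prems(1) by (intro Ck_on_foldr_partial_on) (simp add: add_ac)
    then have "partial_on S j ((partial_on S i ^^ \<alpha> i) h) x = (partial_on S i ^^ \<alpha> i) (partial_on S j h) x"
      using partial_on_funpow_commute Cons.prems(2) S by blast
    also have "\<dots> = (partial_on S i ^^ \<alpha> i)
        (foldr (\<lambda>i h. (partial_on S i ^^ (\<alpha>(j := Suc (\<alpha> j))) i) h) xs f) x"
      unfolding h_def using Cons False
      by (intro partial_on_funpow_cong Cons.IH) (auto intro: Ck_on_le)
    finally show ?thesis using False by (simp add: h_def)
  qed
qed simp

lemma sum_list_sorted_UNIV:
  "sum_list (map \<alpha> (sorted_list_of_set UNIV)) = multi_order (\<alpha> :: 'n::{finite,linorder} \<Rightarrow> nat)"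
  by (simp add: multi_order_def sum_list_distinct_conv_sum_set)

lemma Ck_on_multi_deriv_on:
  "Ck_on (multi_order \<alpha> + l) S f \<Longrightarrow> Ck_on l S (multi_deriv_on S \<alpha> f)"
  unfolding multi_deriv_on_def
  by (rule Ck_on_foldr_partial_on) (simp add: sum_list_sorted_UNIV)

lemma partial_on_multi_deriv_on:
  fixes f :: "real^'n::{finite,linorder} \<Rightarrow> real"
  assumes "Ck_on (Suc (multi_order \<alpha>)) S f" and "x \<in> S" and "S = closure (interior S)"
  shows "partial_on S j (multi_deriv_on S \<alpha> f) x = multi_deriv_on S (\<alpha>(j := Suc (\<alpha> j))) f x"
  unfolding multi_deriv_on_def using assms
  by (intro partial_on_foldr) (auto simp: sum_list_sorted_UNIV)

subsection \<open>Higher derivatives along a polynomial curve\<close>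

lemma multi_order_upd_Suc: "multi_order (\<alpha>(i := Suc (\<alpha> i))) = Suc (multi_order \<alpha>)"
proof -
  have "(\<Sum>j\<in>UNIV - {i}. (\<alpha>(i := Suc (\<alpha> i))) j) = (\<Sum>j\<in>UNIV - {i}. \<alpha> j)"
    by (intro sum.cong) auto
  then show ?thesis
    by (simp add: multi_order_def sum.remove[of UNIV i] del: fun_upd_apply) simp
qed

lemma multi_order_upd_pred:
  assumes "\<alpha> i > 0"
  shows "multi_order \<alpha> = Suc (multi_order (\<alpha>(i := \<alpha> i - 1)))"
  using multi_order_upd_Suc[of "\<alpha>(i := \<alpha> i - 1)" i] assms by simp

text \<open>Bounds the number of terms in the recursion for P_{k+1,\<alpha>} by the order instead of
  the dimension.\<close>

lemma card_support_le_multi_order: "card {i. \<alpha> i > 0} \<le> multi_order \<alpha>"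
proof -
  have "card {i. \<alpha> i > 0} = (\<Sum>i | \<alpha> i > 0. 1)" by simp
  also have "\<dots> \<le> (\<Sum>i | \<alpha> i > 0. \<alpha> i)" by (intro sum_mono) auto
  also have "\<dots> \<le> multi_order \<alpha>" unfolding multi_order_def by (intro sum_mono2) auto
  finally show ?thesis .
qed

lemma finite_multi_order_le: "finite {\<alpha> :: 'n::finite \<Rightarrow> nat. multi_order \<alpha> \<le> k}"
proof (rule finite_subset)
  have "\<alpha> i \<le> multi_order \<alpha>" for \<alpha> :: "'n \<Rightarrow> nat" and i
    unfolding multi_order_def by (rule member_le_sum) auto
  then show "{\<alpha> :: 'n \<Rightarrow> nat. multi_order \<alpha> \<le> k} \<subseteq> PiE UNIV (\<lambda>_. {..k})"
    using le_trans by (fastforce simp: PiE_def)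
qed (auto intro: finite_PiE)

text \<open>
  The \<open>k\<close>-th derivative of \<open>f \<circ> q\<close> is $\sum_\alpha f^{(\alpha)}(q)\, P_{k,\alpha}$ with
  \<open>P\<^sub>k\<^sub>,\<^sub>\<alpha> = curve_coeff q k \<alpha>\<close>; the recursion comes from differentiating this sum once.
\<close>

primrec curve_coeff :: "('n::finite \<Rightarrow> real poly) \<Rightarrow> nat \<Rightarrow> ('n \<Rightarrow> nat) \<Rightarrow> real poly" where
  "curve_coeff q 0 \<alpha> = (if \<alpha> = (\<lambda>_. 0) then 1 else 0)"
| "curve_coeff q (Suc k) \<alpha> = pderiv (curve_coeff q k \<alpha>)
     + (\<Sum>i | \<alpha> i > 0. curve_coeff q k (\<alpha>(i := \<alpha> i - 1)) * pderiv (q i))"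

text \<open>Each differentiation of the composition raises the order of the derivatives of f by at
  most one.\<close>

lemma curve_coeff_eq_0: "k < multi_order \<alpha> \<Longrightarrow> curve_coeff q k \<alpha> = 0"
proof (induction k arbitrary: \<alpha>)
  case 0
  then show ?case by (auto simp: multi_order_def)
next
  case (Suc k)
  then show ?case by (auto intro!: sum.neutral simp: multi_order_upd_pred)
qed

text \<open>Differentiating a coefficient lowers exponents by one; multiplying by a derivative of
  \<open>q i\<close> raises them by at most s - 1 while |\<alpha>| grows by one. Either way the
  inequality survives. Stated for coefficients, it gives both the degree bound and the vanishing for
  |\<alpha>| s < k, which a degree in truncated subtraction could not express.\<close>

lemma coeff_curve_coeff_nonzero:
  assumes deg: "\<And>i. degree (q i) \<le> s" and "coeff (curve_coeff q k \<alpha>) j \<noteq> 0"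
  shows "j + k \<le> multi_order \<alpha> * s"
  using assms(2)
proof (induction k arbitrary: \<alpha> j)
  case 0
  then show ?case by (cases "j = 0") (auto split: if_splits simp: coeff_eq_0)
next
  case (Suc k)
  show ?case
  proof (cases "coeff (pderiv (curve_coeff q k \<alpha>)) j = 0")
    case False
    then show ?thesis using Suc.IH[of \<alpha> "Suc j"] by (simp add: coeff_pderiv)
  next
    case True
    then have "(\<Sum>i | \<alpha> i > 0. coeff (curve_coeff q k (\<alpha>(i := \<alpha> i - 1)) * pderiv (q i)) j) \<noteq> 0"
      using Suc.prems by (simp add: coeff_sum)
    then obtain i where i: "\<alpha> i > 0" "coeff (curve_coeff q k (\<alpha>(i := \<alpha> i - 1)) * pderiv (q i)) j \<noteq> 0"
      by (auto elim: sum.not_neutral_contains_not_neutral)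
    then obtain l where l: "l \<le> j" "coeff (curve_coeff q k (\<alpha>(i := \<alpha> i - 1))) l \<noteq> 0"
        "coeff (pderiv (q i)) (j - l) \<noteq> 0"
      by (auto simp: coeff_mult elim!: sum.not_neutral_contains_not_neutral)
    have "l + k \<le> multi_order (\<alpha>(i := \<alpha> i - 1)) * s"
      using Suc.IH l(2) by blast
    moreover have "Suc (j - l) \<le> s"
      using l(3) deg[of i] le_degree[of "q i" "Suc (j - l)"] by (simp add: coeff_pderiv)
    ultimately show ?thesis
      using l(1) by (simp add: multi_order_upd_pred[of \<alpha> i, OF i(1)])
  qed
qed

lemma curve_coeff_eq_0_low:
  assumes "\<And>i. degree (q i) \<le> s" and "multi_order \<alpha> * s < k"
  shows "curve_coeff q k \<alpha> = 0"
  using coeff_curve_coeff_nonzero[of q s k \<alpha>] assms by (fastforce simp: poly_eq_iff)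

lemma degree_curve_coeff_le:
  assumes "\<And>i. degree (q i) \<le> s"
  shows "degree (curve_coeff q k \<alpha>) \<le> multi_order \<alpha> * s"
  using coeff_curve_coeff_nonzero[of q s k \<alpha>] assms by (fastforce intro: degree_le)

text \<open>The bound does not depend on \<alpha>, so it applies to all shifted indices in the
  recursion. The derivative of P_{k,\<alpha>} contributes 2 (k s)^2, and the at most k + 1 products
  contribute 2 s^2 each, as the q_i are bounded by 1; the sum is the factor with l = k.\<close>

lemma abs_curve_coeff_le:
  assumes deg: "\<And>i. degree (q i) \<le> s" and bound: "\<And>i t. \<bar>t\<bar> \<le> 1 \<Longrightarrow> \<bar>poly (q i) t\<bar> \<le> 1"
    and "\<bar>t\<bar> \<le> 1"
  shows "\<bar>poly (curve_coeff q k \<alpha>) t\<bar> \<le> (\<Prod>l<k. 2 * (real s)\<^sup>2 * ((real l)\<^sup>2 + real l + 1))"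
  using assms(3)
proof (induction k arbitrary: \<alpha> t)
  case (Suc k)
  define M where "M = (\<Prod>l<k. 2 * (real s)\<^sup>2 * ((real l)\<^sup>2 + real l + 1))"
  have IH: "\<bar>poly (curve_coeff q k \<beta>) u\<bar> \<le> M" if "\<bar>u\<bar> \<le> 1" for \<beta> u
    using Suc.IH that by (simp add: M_def)
  have M: "M \<ge> 0" by (simp add: M_def prod_nonneg)
  \<comment> \<open>A uniform degree bound k s is available because only |\<alpha>| \<le> k gives a
    nonzero polynomial.\<close>
  have 1: "\<bar>poly (pderiv (curve_coeff q k \<alpha>)) t\<bar> \<le> 2 * (real s)\<^sup>2 * (real k)\<^sup>2 * M"
  proof (cases "k < multi_order \<alpha>")
    case True
    then show ?thesis using M by (simp add: curve_coeff_eq_0)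
  next
    case False
    have "degree (curve_coeff q k \<alpha>) \<le> k * s"
      using degree_curve_coeff_le[of q s k \<alpha>] deg False
      by (meson le_trans mult_le_mono1 not_less)
    from Markov_weak[OF this IH Suc.prems] show ?thesis
      by (simp add: power_mult_distrib mult_ac)
  qed
  have 2: "\<bar>\<Sum>i | \<alpha> i > 0. poly (curve_coeff q k (\<alpha>(i := \<alpha> i - 1)) * pderiv (q i)) t\<bar>
      \<le> (real k + 1) * (2 * (real s)\<^sup>2 * M)"
  proof (cases "Suc k < multi_order \<alpha>")
    case True
    have "poly (curve_coeff q k (\<alpha>(i := \<alpha> i - 1)) * pderiv (q i)) t = 0" if "\<alpha> i > 0" for i
      using True multi_order_upd_pred[of \<alpha> i] that by (simp add: curve_coeff_eq_0)
    then have "(\<Sum>i | \<alpha> i > 0. poly (curve_coeff q k (\<alpha>(i := \<alpha> i - 1)) * pderiv (q i)) t) = 0"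
      by (intro sum.neutral) blast
    then show ?thesis using M by (simp only: abs_zero) simp
  next
    case False
    have "\<bar>\<Sum>i | \<alpha> i > 0. poly (curve_coeff q k (\<alpha>(i := \<alpha> i - 1)) * pderiv (q i)) t\<bar>
        \<le> (\<Sum>i | \<alpha> i > 0. 2 * (real s)\<^sup>2 * M)"
    proof (rule order_trans[OF sum_abs sum_mono])
      fix i
      have "\<bar>poly (pderiv (q i)) t\<bar> \<le> 2 * (real s)\<^sup>2"
        using Markov_weak[OF deg bound Suc.prems, of i] by simp
      then have "\<bar>poly (curve_coeff q k (\<alpha>(i := \<alpha> i - 1))) t\<bar> * \<bar>poly (pderiv (q i)) t\<bar>
          \<le> M * (2 * (real s)\<^sup>2)"
        using IH Suc.prems M by (intro mult_mono) auto
      then show "\<bar>poly (curve_coeff q k (\<alpha>(i := \<alpha> i - 1)) * pderiv (q i)) t\<bar> \<le> 2 * (real s)\<^sup>2 * M"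
        by (simp add: abs_mult mult.commute)
    qed
    also have "\<dots> = real (card {i. \<alpha> i > 0}) * (2 * (real s)\<^sup>2 * M)" by simp
    also have "\<dots> \<le> (real k + 1) * (2 * (real s)\<^sup>2 * M)"
    proof (rule mult_right_mono)
      have "card {i. \<alpha> i > 0} \<le> Suc k"
        using card_support_le_multi_order[of \<alpha>] False by linarith
      then show "real (card {i. \<alpha> i > 0}) \<le> real k + 1" by linarith
    qed (use M in simp)
    finally show ?thesis .
  qed
  have "\<bar>poly (curve_coeff q (Suc k) \<alpha>) t\<bar>
      \<le> 2 * (real s)\<^sup>2 * (real k)\<^sup>2 * M + (real k + 1) * (2 * (real s)\<^sup>2 * M)"
    using 1 2 by (simp add: poly_sum)
  also have "\<dots> = (\<Prod>l<Suc k. 2 * (real s)\<^sup>2 * ((real l)\<^sup>2 + real l + 1))"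
    unfolding prod.lessThan_Suc M_def[symmetric] by (simp add: algebra_simps)
  finally show ?case .
qed simp

text \<open>Factor by factor: 2 \<le> n + 1, and l^2 + l + 1 \<le> (l + 1)^2 \<le> (d + 1)^2 \<le>
  (d + 1)^(n + 2).\<close>

lemma prod_le_inverse_curve_const:
  assumes "n \<ge> 1"
  shows "(\<Prod>l<d + 1. 2 * (real s)\<^sup>2 * ((real l)\<^sup>2 + real l + 1)) \<le> 1 / curve_const n d s"
proof -
  define m where "m = d + 1"
  have "(\<Prod>l<m. 2 * (real s)\<^sup>2 * ((real l)\<^sup>2 + real l + 1))
      \<le> (\<Prod>l<m. (real s)\<^sup>2 * real (n + 1) * real m ^ (n + 2))"
  proof (intro prod_mono conjI)
    fix l assume "l \<in> {..<m}"
    then have "(real l + 1)\<^sup>2 \<le> (real m)\<^sup>2" by (intro power_mono) auto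
    then have "(real l)\<^sup>2 + real l + 1 \<le> (real m)\<^sup>2" by (simp add: power2_eq_square algebra_simps)
    also have "\<dots> \<le> real m ^ (n + 2)" by (intro power_increasing) (auto simp: m_def)
    finally have "2 * ((real l)\<^sup>2 + real l + 1) \<le> real (n + 1) * real m ^ (n + 2)"
      using assms by (intro mult_mono) auto
    then have "(real s)\<^sup>2 * (2 * ((real l)\<^sup>2 + real l + 1)) \<le> (real s)\<^sup>2 * (real (n + 1) * real m ^ (n + 2))"
      by (intro mult_left_mono) auto
    then show "2 * (real s)\<^sup>2 * ((real l)\<^sup>2 + real l + 1) \<le> (real s)\<^sup>2 * real (n + 1) * real m ^ (n + 2)"
      by (simp only: mult_ac)
  qed (auto intro!: mult_nonneg_nonneg add_nonneg_nonneg)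
  also have "\<dots> = 1 / curve_const n d s"
    by (simp add: curve_const_def m_def[symmetric, simplified] power_mult_distrib power_mult[symmetric] mult.commute
        del: power_Suc)
  finally show ?thesis by (simp add: m_def)
qed

text \<open>Moves the increment of the multi-index from the derivative of f to its coefficient,
  where the recursion expects a decrement.\<close>

lemma sum_multi_index_shift:
  fixes F :: "('n::finite \<Rightarrow> nat) \<Rightarrow> real"
  shows "(\<Sum>\<alpha> | multi_order \<alpha> \<le> k. F (\<alpha>(i := Suc (\<alpha> i)))) = (\<Sum>\<alpha> | multi_order \<alpha> \<le> Suc k \<and> \<alpha> i > 0. F \<alpha>)"
  by (rule sum.reindex_bij_witness[of _ "\<lambda>\<alpha>. \<alpha>(i := \<alpha> i - 1)" "\<lambda>\<alpha>. \<alpha>(i := Suc (\<alpha> i))"])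
    (auto simp: multi_order_upd_Suc multi_order_upd_pred)

lemma nth_deriv_on_polynomial_curve:
  fixes f :: "real^'n::{finite,linorder} \<Rightarrow> real" and \<omega> :: "real \<Rightarrow> real^'n::{finite,linorder}"
  assumes f: "Ck_on m S f" and S: "S = closure (interior S)" and ab: "a < b"
    and q: "\<And>i t. t \<in> {a..b} \<Longrightarrow> \<omega> t $ i = poly (q i) t" and sub: "\<omega> ` {a..b} \<subseteq> S"
    and "k \<le> m" "t \<in> {a..b}"
  shows "nth_deriv_on {a..b} k (\<lambda>t. f (\<omega> t)) t
    = (\<Sum>\<alpha> | multi_order \<alpha> \<le> k. multi_deriv_on S \<alpha> f (\<omega> t) * poly (curve_coeff q k \<alpha>) t)"
  using assms(6,7)
proof (induction k arbitrary: t)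
  case 0
  have "{\<alpha> :: 'n \<Rightarrow> nat. multi_order \<alpha> \<le> 0} = {\<lambda>_. 0}"
    by (auto simp: multi_order_def)
  moreover have "foldr (\<lambda>i h. h) xs f = f" for xs :: "'n list"
    by (induction xs) auto
  ultimately show ?case
    by (simp add: nth_deriv_on_def multi_deriv_on_def)
next
  case (Suc k)
  define F where "F = (\<lambda>\<alpha> u. multi_deriv_on S \<alpha> f (\<omega> u))"
  define P where "P = curve_coeff q"
  have finite [simp]: "finite {\<alpha> :: 'n \<Rightarrow> nat. multi_order \<alpha> \<le> k}" for k
    by (rule finite_multi_order_le)
  have \<omega>: "(\<omega> has_vector_derivative (\<chi> i. poly (pderiv (q i)) t)) (at t within {a..b})"
  proof (rule has_vector_derivative_transform[OF Suc.prems(2)])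
    show "\<omega> u = (\<chi> i. poly (q i) u)" if "u \<in> {a..b}" for u
      using q[OF that] by (simp add: vec_eq_iff)
    show "((\<lambda>u. \<chi> i. poly (q i) u) has_vector_derivative (\<chi> i. poly (pderiv (q i)) t)) (at t within {a..b})"
      unfolding has_vector_derivative_def
      by (rule has_derivative_componentwise_within[THEN iffD2])
        (auto simp: Basis_vec_def inner_axis intro!: DERIV_subset[OF poly_DERIV, unfolded has_field_derivative_def, THEN has_derivative_eq_rhs])
  qed
  have dF: "(F \<alpha> has_vector_derivative (\<Sum>i\<in>UNIV. poly (pderiv (q i)) t * F (\<alpha>(i := Suc (\<alpha> i))) t))
      (at t within {a..b})" if "multi_order \<alpha> \<le> k" for \<alpha>
  proof -
    have "Ck_on (Suc 0) S (multi_deriv_on S \<alpha> f)"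
      using Suc.prems(1) that by (intro Ck_on_multi_deriv_on Ck_on_le[OF f]) auto
    then have "(F \<alpha> has_vector_derivative
        (\<Sum>i\<in>UNIV. (\<chi> i. poly (pderiv (q i)) t) $ i * partial_on S i (multi_deriv_on S \<alpha> f) (\<omega> t)))
        (at t within {a..b})"
      unfolding F_def using Suc.prems(2) sub
      by (intro differentiable_on_chain_vector_derivative[OF _ \<omega>]) auto
    moreover have "partial_on S i (multi_deriv_on S \<alpha> f) (\<omega> t) = F (\<alpha>(i := Suc (\<alpha> i))) t" for i
      unfolding F_def using Suc.prems sub that
      by (intro partial_on_multi_deriv_on[OF _ _ S] Ck_on_le[OF f]) auto
    ultimately show ?thesis by simp
  qed
  have "((\<lambda>u. \<Sum>\<alpha> | multi_order \<alpha> \<le> k. F \<alpha> u * poly (P k \<alpha>) u) has_vector_derivative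
      (\<Sum>\<alpha> | multi_order \<alpha> \<le> k. F \<alpha> t * poly (pderiv (P k \<alpha>)) t
        + (\<Sum>i\<in>UNIV. poly (pderiv (q i)) t * F (\<alpha>(i := Suc (\<alpha> i))) t) * poly (P k \<alpha>) t)) (at t within {a..b})"
    by (intro has_vector_derivative_sum has_vector_derivative_mult dF)
      (auto simp: has_real_derivative_iff_has_vector_derivative[symmetric] intro: DERIV_subset[OF poly_DERIV])
  \<comment> \<open>The induction hypothesis holds on the whole interval, so both sides have the
    same derivative within it, one-sided at the end points.\<close>
  then have "(nth_deriv_on {a..b} k (\<lambda>t. f (\<omega> t)) has_vector_derivative
      (\<Sum>\<alpha> | multi_order \<alpha> \<le> k. F \<alpha> t * poly (pderiv (P k \<alpha>)) t
        + (\<Sum>i\<in>UNIV. poly (pderiv (q i)) t * F (\<alpha>(i := Suc (\<alpha> i))) t) * poly (P k \<alpha>) t)) (at t within {a..b})"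
    using Suc by (elim has_vector_derivative_transform[rotated 2]) (auto simp: F_def P_def)
  then have "nth_deriv_on {a..b} (Suc k) (\<lambda>t. f (\<omega> t)) t
      = (\<Sum>\<alpha> | multi_order \<alpha> \<le> k. F \<alpha> t * poly (pderiv (P k \<alpha>)) t
        + (\<Sum>i\<in>UNIV. poly (pderiv (q i)) t * F (\<alpha>(i := Suc (\<alpha> i))) t) * poly (P k \<alpha>) t)"
    using vector_derivative_within_closed_interval[OF ab Suc.prems(2)]
    by (simp add: nth_deriv_on_def)
  also have "\<dots> = (\<Sum>\<alpha> | multi_order \<alpha> \<le> k. F \<alpha> t * poly (pderiv (P k \<alpha>)) t)
      + (\<Sum>i\<in>UNIV. \<Sum>\<alpha> | multi_order \<alpha> \<le> k. F (\<alpha>(i := Suc (\<alpha> i))) t * poly (P k \<alpha> * pderiv (q i)) t)"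
    by (subst sum.swap) (simp add: sum.distrib sum_distrib_left sum_distrib_right mult_ac)
  \<comment> \<open>The added terms have order k + 1 and coefficient P_{k,\<alpha>} = 0.\<close>
  also have "(\<Sum>\<alpha> | multi_order \<alpha> \<le> k. F \<alpha> t * poly (pderiv (P k \<alpha>)) t)
      = (\<Sum>\<alpha> | multi_order \<alpha> \<le> Suc k. F \<alpha> t * poly (pderiv (P k \<alpha>)) t)"
    by (intro sum.mono_neutral_left) (auto simp: P_def curve_coeff_eq_0)
  also have "(\<Sum>i\<in>UNIV. \<Sum>\<alpha> | multi_order \<alpha> \<le> k. F (\<alpha>(i := Suc (\<alpha> i))) t * poly (P k \<alpha> * pderiv (q i)) t)
      = (\<Sum>i\<in>UNIV. \<Sum>\<alpha> | multi_order \<alpha> \<le> Suc k \<and> \<alpha> i > 0.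
          F \<alpha> t * poly (P k (\<alpha>(i := \<alpha> i - 1)) * pderiv (q i)) t)"
  proof (rule sum.cong[OF refl])
    fix i
    show "(\<Sum>\<alpha> | multi_order \<alpha> \<le> k. F (\<alpha>(i := Suc (\<alpha> i))) t * poly (P k \<alpha> * pderiv (q i)) t)
        = (\<Sum>\<alpha> | multi_order \<alpha> \<le> Suc k \<and> \<alpha> i > 0. F \<alpha> t * poly (P k (\<alpha>(i := \<alpha> i - 1)) * pderiv (q i)) t)"
      using sum_multi_index_shift[of "\<lambda>\<alpha>. F \<alpha> t * poly (P k (\<alpha>(i := \<alpha> i - 1)) * pderiv (q i)) t" i k]
      by simp
  qed
  also have "\<dots> = (\<Sum>\<alpha> | multi_order \<alpha> \<le> Suc k. \<Sum>i | \<alpha> i > 0.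
      F \<alpha> t * poly (P k (\<alpha>(i := \<alpha> i - 1)) * pderiv (q i)) t)"
    using sum.swap_restrict[of UNIV "{\<alpha>. multi_order \<alpha> \<le> Suc k}"
        "\<lambda>i \<alpha>. F \<alpha> t * poly (P k (\<alpha>(i := \<alpha> i - 1)) * pderiv (q i)) t" "\<lambda>i \<alpha>. \<alpha> i > 0"]
    by simp
  finally show ?case
    by (simp add: F_def P_def poly_sum sum.distrib[symmetric] sum_distrib_left distrib_left)
qed

text \<open>An integer below the ceiling of a number is below the number itself. The strict
  inequality is what makes the coefficient vanish.\<close>

lemma multi_order_less_lowest_order:
  assumes "s \<ge> 1" "multi_order \<alpha> < lowest_order d s"
  shows "multi_order \<alpha> * s < d + 1"
proof -
  have "int (multi_order \<alpha>) < \<lceil>real (d + 1) / real s\<rceil>"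
    using assms(2) by (simp add: lowest_order_def zless_nat_eq_int_zless)
  then have "real (multi_order \<alpha>) < real (d + 1) / real s"
    by (simp add: less_ceiling_iff)
  then have "real (multi_order \<alpha> * s) < real (d + 1)"
    using assms(1) by (simp add: pos_less_divide_eq)
  then show ?thesis by linarith
qed

theorem theorem1p2:
  fixes f :: "real^'n::{finite,linorder} \<Rightarrow> real"
    and \<omega> :: "real \<Rightarrow> real^'n::{finite,linorder}"
    and d s :: nat
  assumes "s \<ge> 1"
    and "Ck_on (d + 1) (cball 0 1) f"
    and "(SUP x\<in>cball 0 1. \<bar>f x\<bar>) = 1"
    and "\<forall>i. \<exists>p :: real poly. degree p \<le> s \<and> (\<forall>t\<in>{-1..1}. \<omega> t $ i = poly p t)"
    and "\<omega> ` {-1..1} \<subseteq> cball 0 1"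
  defines "g \<equiv> \<lambda>t. f (\<omega> t)"
  shows "curve_const CARD('n) d s > 0 \<and>
    (\<forall>t\<in>{-1..1}.
      (\<Sum>\<alpha> | lowest_order d s \<le> multi_order \<alpha> \<and> multi_order \<alpha> \<le> d + 1.
         \<bar>multi_deriv_on (cball 0 1) \<alpha> f (\<omega> t)\<bar>)
      \<ge> curve_const CARD('n) d s * \<bar>nth_deriv_on {-1..1} (d + 1) g t\<bar>) \<and>
    (\<Sum>\<alpha> | lowest_order d s \<le> multi_order \<alpha> \<and> multi_order \<alpha> \<le> d + 1.
       SUP t\<in>{-1..1}. \<bar>multi_deriv_on (cball 0 1) \<alpha> f (\<omega> t)\<bar>)
    \<ge> curve_const CARD('n) d s * (SUP t\<in>{-1..1}. \<bar>nth_deriv_on {-1..1} (d + 1) g t\<bar>)"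
proof -
  let ?C = "curve_const CARD('n) d s" and ?B = "cball 0 1 :: (real^'n::{finite,linorder}) set"
  let ?A = "{\<alpha> :: 'n \<Rightarrow> nat. lowest_order d s \<le> multi_order \<alpha> \<and> multi_order \<alpha> \<le> d + 1}"
  have C: "?C > 0"
    using assms(1) by (simp add: curve_const_def)
  obtain q where deg: "\<And>i. degree (q i) \<le> s" and q: "\<And>i t. t \<in> {-1..1} \<Longrightarrow> \<omega> t $ i = poly (q i) t"
    using assms(4) by metis
  \<comment> \<open>Coordinates of points of the unit ball are bounded by 1: the bound required for
    Markov's inequality.\<close>
  have q_le: "\<bar>poly (q i) t\<bar> \<le> 1" if "\<bar>t\<bar> \<le> 1" for i t
  proof -
    have t: "t \<in> {-1..1}" using that by auto
    then have "norm (\<omega> t) \<le> 1" using assms(5) by (auto simp: image_subset_iff)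
    then show ?thesis
      using component_le_norm_cart[of "\<omega> t" i] q[OF t, of i] by simp
  qed
  have pointwise: "?C * \<bar>nth_deriv_on {-1..1} (d + 1) g t\<bar> \<le> (\<Sum>\<alpha>\<in>?A. \<bar>multi_deriv_on ?B \<alpha> f (\<omega> t)\<bar>)"
    if t: "t \<in> {-1..1}" for t
  proof -
    have "nth_deriv_on {-1..1} (d + 1) g t = (\<Sum>\<alpha> | multi_order \<alpha> \<le> d + 1.
        multi_deriv_on ?B \<alpha> f (\<omega> t) * poly (curve_coeff q (d + 1) \<alpha>) t)"
      unfolding g_def
      by (rule nth_deriv_on_polynomial_curve[OF assms(2) _ _ q assms(5) order_refl t])
        (auto simp: interior_cball)
    also have "\<dots> = (\<Sum>\<alpha>\<in>?A. multi_deriv_on ?B \<alpha> f (\<omega> t) * poly (curve_coeff q (d + 1) \<alpha>) t)"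
      (is "_ = ?S")
    proof (rule sum.mono_neutral_right[OF finite_multi_order_le])
      show "\<forall>\<alpha>\<in>{\<alpha>. multi_order \<alpha> \<le> d + 1} - ?A.
          multi_deriv_on ?B \<alpha> f (\<omega> t) * poly (curve_coeff q (d + 1) \<alpha>) t = 0"
      proof
        fix \<alpha> :: "'n \<Rightarrow> nat" assume "\<alpha> \<in> {\<alpha>. multi_order \<alpha> \<le> d + 1} - ?A"
        then have "multi_order \<alpha> < lowest_order d s" by auto
        then have "curve_coeff q (d + 1) \<alpha> = 0"
          using curve_coeff_eq_0_low deg multi_order_less_lowest_order[OF assms(1)] by blast
        then show "multi_deriv_on ?B \<alpha> f (\<omega> t) * poly (curve_coeff q (d + 1) \<alpha>) t = 0"
          by (simp only: poly_0 mult_zero_right)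
      qed
    qed auto
    finally have eq: "nth_deriv_on {-1..1} (d + 1) g t = ?S" .
    have "\<bar>?S\<bar> \<le> (\<Sum>\<alpha>\<in>?A. \<bar>multi_deriv_on ?B \<alpha> f (\<omega> t)\<bar> * (1 / ?C))"
    proof (rule order_trans[OF sum_abs sum_mono])
      fix \<alpha>
      have "\<bar>poly (curve_coeff q (d + 1) \<alpha>) t\<bar>
          \<le> (\<Prod>l<d + 1. 2 * (real s)\<^sup>2 * ((real l)\<^sup>2 + real l + 1))"
        by (rule abs_curve_coeff_le[OF deg q_le]) (use t in auto)
      also have "\<dots> \<le> 1 / ?C"
        by (rule prod_le_inverse_curve_const) (simp add: Suc_le_eq)
      finally show "\<bar>multi_deriv_on ?B \<alpha> f (\<omega> t) * poly (curve_coeff q (d + 1) \<alpha>) t\<bar>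
          \<le> \<bar>multi_deriv_on ?B \<alpha> f (\<omega> t)\<bar> * (1 / ?C)"
        unfolding abs_mult by (intro mult_left_mono) auto
    qed
    also have "\<dots> = (\<Sum>\<alpha>\<in>?A. \<bar>multi_deriv_on ?B \<alpha> f (\<omega> t)\<bar>) * (1 / ?C)"
      by (rule sum_distrib_right[symmetric])
    finally have "\<bar>nth_deriv_on {-1..1} (d + 1) g t\<bar> \<le> (\<Sum>\<alpha>\<in>?A. \<bar>multi_deriv_on ?B \<alpha> f (\<omega> t)\<bar>) * (1 / ?C)"
      unfolding eq .
    then have "\<bar>nth_deriv_on {-1..1} (d + 1) g t\<bar> * ?C \<le> (\<Sum>\<alpha>\<in>?A. \<bar>multi_deriv_on ?B \<alpha> f (\<omega> t)\<bar>)"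
      using C by (simp only: mult_1_right times_divide_eq_right pos_le_divide_eq)
    then show ?thesis by (simp only: mult.commute)
  qed
  have \<omega>: "continuous_on {-1..1} \<omega>"
    by (rule continuous_on_eq[of _ "\<lambda>t. \<chi> i. poly (q i) t"])
      (auto intro!: continuous_on_vec_lambda continuous_intros simp: vec_eq_iff q)
  \<comment> \<open>A real \<open>SUP\<close> dominates its family only if that is bounded above;
    here continuity on a compact interval ensures this.\<close>
  have bdd: "bdd_above ((\<lambda>t. \<bar>multi_deriv_on ?B \<alpha> f (\<omega> t)\<bar>) ` {-1..1})" if "\<alpha> \<in> ?A" for \<alpha>
  proof -
    have "continuous_on ?B (multi_deriv_on ?B \<alpha> f)"
      using that by (intro Ck_on_continuous[of 0] Ck_on_multi_deriv_on Ck_on_le[OF assms(2)]) auto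
    then have "continuous_on {-1..1} (\<lambda>t. \<bar>multi_deriv_on ?B \<alpha> f (\<omega> t)\<bar>)"
      by (intro continuous_on_rabs continuous_on_compose2[OF _ \<omega> assms(5)])
    then show ?thesis
      by (intro bounded_imp_bdd_above compact_imp_bounded compact_continuous_image) auto
  qed
  \<comment> \<open>Dividing by the constant gives an upper bound independent of t for the
    supremum.\<close>
  have "(SUP t\<in>{-1..1}. \<bar>nth_deriv_on {-1..1} (d + 1) g t\<bar>)
      \<le> (\<Sum>\<alpha>\<in>?A. SUP t\<in>{-1..1}. \<bar>multi_deriv_on ?B \<alpha> f (\<omega> t)\<bar>) / ?C"
  proof (rule cSUP_least)
    fix t :: real assume t: "t \<in> {-1..1}"
    have "(\<Sum>\<alpha>\<in>?A. \<bar>multi_deriv_on ?B \<alpha> f (\<omega> t)\<bar>)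
        \<le> (\<Sum>\<alpha>\<in>?A. SUP t\<in>{-1..1}. \<bar>multi_deriv_on ?B \<alpha> f (\<omega> t)\<bar>)"
      using bdd t by (intro sum_mono cSUP_upper) auto
    then show "\<bar>nth_deriv_on {-1..1} (d + 1) g t\<bar>
        \<le> (\<Sum>\<alpha>\<in>?A. SUP t\<in>{-1..1}. \<bar>multi_deriv_on ?B \<alpha> f (\<omega> t)\<bar>) / ?C"
      using pointwise[OF t] C by (simp only: pos_le_divide_eq mult.commute)
  qed simp
  then show ?thesis
    using C pointwise by (simp add: pos_le_divide_eq mult.commute)
qed

end
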